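(* Let $pds_{2D}(n)$ be the number of (two-dimensional, non-oriented) partially directed snakes of length $n$. Then, as formal power series, $$\sum_{n\ge 0} pds_{2D}(n)\,q^n=\frac{q^5+q^3+q^2-2q+1}{(1-q)(1-2q-q^3)}.$$ Moreover $pds_{2D}(0)=pds_{2D}(1)=1$ and for all $n\ge 2$ $$pds_{2D}(n)=\frac{1}{59}\sum_{\alpha:\,1-2\alpha-\alpha^3=0}\left(13\alpha^{-1}+11-5\alpha\right)\alpha^{-n}\;-\;1,$$ where the sum runs over the complex roots $\alpha$ of $1-2\alpha-\alpha^3$.
   Context: Cells are the unit squares of the square lattice; two cells are adjacent if they share an edge. A polyomino is a finite edge-connected set of cells, considered up to translation; it is viewed as a graph with cells as vertices and edge contacts as edges. A snake of length $n$ is a polyomino with $n$ cells, no cycle, and every cell of degree at most two (so its adjacency graph is a path). Snakes are non-oriented, i.e. counted as sets of cells up to translation. A snake is a partially directed snake (PDS) towards the North if its cells can be listed $c_1,\dots,c_n$ from one end of the path (the tail) to the other (the head) so that each step from $c_i$ to $c_{i+1}$ is in one of the directions North, East or West. By convention the empty snake is the unique PDS of length $0$. *)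

theory Defs
  imports
    Complex_Main
    "HOL-Library.Product_Plus"
    "HOL-Computational_Algebra.Formal_Power_Series"
begin

(* A cell is represented by the integer coordinates of its lower left corner. *)
type_synonym cell = "int \<times> int"

definition adjacent :: "cell \<Rightarrow> cell \<Rightarrow> bool" where
  "adjacent a b \<longleftrightarrow> \<bar>fst a - fst b\<bar> + \<bar>snd a - snd b\<bar> = 1"

definition edge_connected :: "cell set \<Rightarrow> bool" where
  "edge_connected S \<longleftrightarrow>
     (\<forall>a\<in>S. \<forall>b\<in>S. (a, b) \<in> {(x, y). x \<in> S \<and> y \<in> S \<and> adjacent x y}\<^sup>*)"

(* Cell sets in a fixed position; translation is factored out when counting.
   The empty set is admitted, because the empty snake is counted. *)
definition polyomino :: "cell set \<Rightarrow> bool" where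
  "polyomino S \<longleftrightarrow> finite S \<and> edge_connected S"

definition has_cycle :: "cell set \<Rightarrow> bool" where
  "has_cycle S \<longleftrightarrow>
     (\<exists>cs. 3 \<le> length cs \<and> distinct cs \<and> set cs \<subseteq> S \<and>
           successively adjacent cs \<and> adjacent (last cs) (hd cs))"

definition degree_in :: "cell set \<Rightarrow> cell \<Rightarrow> nat" where
  "degree_in S a = card {b \<in> S. adjacent a b}"

definition snake :: "cell set \<Rightarrow> bool" where
  "snake S \<longleftrightarrow> polyomino S \<and> \<not> has_cycle S \<and> (\<forall>a\<in>S. degree_in S a \<le> 2)"

definition north_east_west_step :: "cell \<Rightarrow> cell \<Rightarrow> bool" where
  "north_east_west_step a b \<longleftrightarrow> b - a \<in> {(0, 1), (1, 0), (-1, 0)}"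

(* A listing of all cells of a snake, without repetition and with consecutive cells
   adjacent, necessarily runs from one end of its adjacency path to the other. *)
definition partially_directed_snake :: "cell set \<Rightarrow> bool" where
  "partially_directed_snake S \<longleftrightarrow>
     snake S \<and>
     (\<exists>cs. distinct cs \<and> set cs = S \<and> successively north_east_west_step cs)"

definition translation_rel :: "(cell set \<times> cell set) set" where
  "translation_rel = {(S, T). \<exists>v. T = (+) v ` S}"

definition pds2D :: "nat \<Rightarrow> nat" where
  "pds2D n = card ({S. partially_directed_snake S \<and> card S = n} // translation_rel)"

end

theory Submission
  imports Defs
begin

text \<open>
  A path with North, East and West steps is a snake exactly when no two steps at distance one or
  two in its step word cancel: a cancelling pair at distance two closes a 2 by 2 square, and
  without cancelling pairs two cells at height difference at most one are adjacent only if they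
  are consecutive. A path graph has only two traversals, and both use North, East and West steps
  only if the snake is a horizontal bar. Hence a partially directed snake with \<open>n \<ge> 2\<close> cells
  corresponds to a unique word of length \<open>n - 1\<close>, except that the all-East and the all-West word
  give the same bar. The numbers \<open>g m\<close> of words satisfy \<open>g (m + 3) = 2 g (m + 2) + g m\<close>, whose
  characteristic roots are the inverses of the roots of \<open>1 - 2 \<alpha> - \<alpha>\<^sup>3\<close>.
\<close>

section \<open>Step words and the paths they trace\<close>

definition step_vectors :: "cell set" where
  "step_vectors = {(0, 1), (1, 0), (-1, 0)}"

text \<open>The window has length two and no more: in the word East, North, North, West the opposite
  letters are at distance three, and its path is a snake.\<close>

fun uncancelled :: "cell list \<Rightarrow> bool" where
  "uncancelled [] \<longleftrightarrow> True"
| "uncancelled (a # w) \<longleftrightarrow> - a \<notin> set (take 2 w) \<and> uncancelled w"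

definition words :: "nat \<Rightarrow> cell list set" where
  "words m = {w. length w = m \<and> set w \<subseteq> step_vectors \<and> uncancelled w}"

fun path :: "cell \<Rightarrow> cell list \<Rightarrow> cell list" where
  "path c [] = [c]"
| "path c (s # w) = c # path (c + s) w"

text \<open>The equivalence ranges over all pairs of indices, so the list has no chords and the
  adjacency graph of its cell set is exactly a path. The index difference is taken in
  \<open>int\<close> to avoid truncated subtraction.\<close>

definition induced_path :: "cell list \<Rightarrow> bool" where
  "induced_path cs \<longleftrightarrow> distinct cs \<and>
     (\<forall>i<length cs. \<forall>j<length cs. adjacent (cs ! i) (cs ! j) \<longleftrightarrow> \<bar>int i - int j\<bar> = 1)"

lemma length_path [simp]: "length (path c w) = Suc (length w)"
  by (induction c w rule: path.induct) auto

lemma path_not_Nil [simp]: "path c w \<noteq> []"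
  by (cases w) auto

lemma hd_path [simp]: "hd (path c w) = c"
  by (cases w) auto

lemma nth_path: "j \<le> length w \<Longrightarrow> path c w ! j = c + sum_list (take j w)"
  by (induction c w arbitrary: j rule: path.induct)
     (auto simp: nth_Cons' take_Cons' add.assoc)

lemma path_translate: "path (c + d) w = map ((+) c) (path d w)"
  by (induction d w arbitrary: c rule: path.induct) (auto simp: add.assoc)

lemma path_inject: "path c w = path d w' \<Longrightarrow> w = w'"
proof (induction c w arbitrary: d w' rule: path.induct)
  case (1 c)
  then have "length (path d w') = 1" by (metis length_path list.size(3) One_nat_def)
  then show ?case by simp
next
  case (2 c s w)
  then obtain s' w'' where w': "w' = s' # w''" by (cases w') auto
  with "2.prems" have eq: "c = d" "path (c + s) w = path (d + s') w''" by auto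
  from eq(2) have "c + s = d + s'" by (metis hd_path)
  with eq "2.IH" w' show ?case by auto
qed

lemma successively_path:
  "successively north_east_west_step (path c w) \<longleftrightarrow> set w \<subseteq> step_vectors"
proof (induction c w rule: path.induct)
  case (2 c s w)
  have "successively north_east_west_step (path c (s # w)) \<longleftrightarrow>
      north_east_west_step c (c + s) \<and> successively north_east_west_step (path (c + s) w)"
    by (simp add: successively_Cons)
  with 2 show ?case by (simp add: north_east_west_step_def step_vectors_def)
qed auto

lemma ex_path:
  assumes "cs \<noteq> []"
  shows "\<exists>w. cs = path (hd cs) w"
  using assms
proof (induction cs)
  case (Cons c cs)
  show ?case
  proof (cases "cs = []")
    case True
    then have "c # cs = path c []" by simp
    then show ?thesis by (metis list.sel(1))
  next
    case False
    with Cons obtain w where "cs = path (hd cs) w" by blast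
    then have "c # cs = path c ((hd cs - c) # w)" by simp
    then show ?thesis by (metis list.sel(1))
  qed
qed simp

section \<open>Displacements along words without cancelling pairs\<close>

lemma step_vectors_cases:
  assumes "s \<in> step_vectors"
  obtains "s = (0, 1)" | "s = (1, 0)" | "s = (-1, 0)"
  using assms by (auto simp: step_vectors_def)

lemma snd_sum_steps_nonneg: "set w \<subseteq> step_vectors \<Longrightarrow> 0 \<le> snd (sum_list w)"
  by (induction w) (auto simp: step_vectors_def)

text \<open>No step goes South, so a prefix of height zero has only horizontal letters. Neighbouring
  letters do not cancel, so they all repeat the first one.\<close>

lemma sum_steps_level:
  assumes "set w \<subseteq> step_vectors" "uncancelled w" "0 < j" "j \<le> length w"
    and "snd (sum_list (take j w)) = 0"
  shows "snd (hd w) = 0 \<and> fst (sum_list (take j w)) = int j * fst (hd w)"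
  using assms
proof (induction w arbitrary: j)
  case (Cons a w)
  then obtain k where k: "j = Suc k" by (cases j) auto
  have nonneg: "0 \<le> snd (sum_list (take k w))"
    using Cons.prems(1) set_take_subset[of k w] by (intro snd_sum_steps_nonneg) auto
  have a: "a \<in> step_vectors" using Cons.prems(1) by simp
  then have "0 \<le> snd a" by (auto simp: step_vectors_def)
  with nonneg Cons.prems(5) k have lvl: "snd a = 0" "snd (sum_list (take k w)) = 0" by auto
  show ?case
  proof (cases "k = 0")
    case True
    with lvl k show ?thesis by simp
  next
    case False
    then obtain b v where w: "w = b # v" using Cons.prems(4) k by (cases w) auto
    have IH: "snd b = 0 \<and> fst (sum_list (take k w)) = int k * fst b"
      using Cons.IH[of k] Cons.prems False k lvl(2) by (auto simp: w)
    have "b \<in> step_vectors" "- a \<noteq> b" using Cons.prems(1,2) by (auto simp: w)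
    with a lvl IH have "b = a" by (auto simp: step_vectors_def)
    with IH lvl k show ?thesis by (simp add: algebra_simps)
  qed
qed simp

text \<open>A prefix of height one contains exactly one North step. The horizontal letters before it
  agree, and those after it must continue in the same direction, so the path never comes back above
  its starting cell.\<close>

lemma sum_steps_next_level:
  assumes "set w \<subseteq> step_vectors" "uncancelled w" "j \<le> length w"
    and "snd (sum_list (take j w)) = 1" "snd (hd w) = 0"
  shows "0 < fst (sum_list (take j w)) * fst (hd w)"
  using assms
proof (induction w arbitrary: j)
  case Nil
  then show ?case by simp
next
  case (Cons a w)
  from Cons.prems(4) obtain k where k: "j = Suc k" by (cases j) auto
  have a: "a \<in> step_vectors" "snd a = 0" using Cons.prems by simp_all
  have sk: "snd (sum_list (take k w)) = 1" using Cons.prems(4) k a by simp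
  then have "k \<noteq> 0" by (cases k) auto
  then obtain b v where w: "w = b # v" using Cons.prems(3) k by (cases w) auto
  obtain l where l: "k = Suc l" using \<open>k \<noteq> 0\<close> by (cases k) auto
  have b: "b \<in> step_vectors" "- a \<noteq> b" using Cons.prems(1,2) by (auto simp: w)
  show ?case
  proof (cases "snd b = 0")
    case True
    with a b have "b = a" by (auto simp: step_vectors_def)
    moreover have "0 < fst (sum_list (take k w)) * fst b"
      using Cons.IH[of k] Cons.prems sk True k by (simp add: w)
    ultimately show ?thesis using a k by (auto simp: step_vectors_def)
  next
    case False
    with b have bN: "b = (0, 1)" by (auto simp: step_vectors_def)
    have sl: "snd (sum_list (take l v)) = 0" using sk by (simp add: w l bN)
    show ?thesis
    proof (cases "l = 0")
      case True
      then show ?thesis using a by (auto simp: k l w bN step_vectors_def)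
    next
      case False
      then obtain c u where v: "v = c # u" using Cons.prems(3) by (cases v) (auto simp: k l w)
      \<comment> \<open>The letters \<open>a\<close> and \<open>c\<close> stand on both sides of the
        North step \<open>b\<close>, at distance two; this is where the second letter of the window
        matters.\<close>
      have c: "c \<in> step_vectors" "- a \<noteq> c" using Cons.prems(1,2) by (auto simp: w v)
      have "snd (hd v) = 0 \<and> fst (sum_list (take l v)) = int l * fst (hd v)"
        using sum_steps_level[of v l] Cons.prems False sl by (simp add: w k l)
      then have fc: "snd c = 0" "fst (sum_list (take l v)) = int l * fst c" by (auto simp: v)
      with a c have "c = a" by (auto simp: step_vectors_def)
      then have "fst (sum_list (take j (a # w))) * fst a = fst a * fst a * (1 + int l)"
        using fc by (simp add: k l w bN algebra_simps)
      moreover have "fst a * fst a = 1" using a by (auto simp: step_vectors_def)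
      ultimately show ?thesis by simp
    qed
  qed
qed

lemma uncancelled_drop: "uncancelled w \<Longrightarrow> uncancelled (drop i w)"
  by (induction w arbitrary: i) (auto simp: drop_Cons')

lemma adjacent_commute: "adjacent a b \<longleftrightarrow> adjacent b a"
  by (auto simp: adjacent_def abs_minus_commute)

lemma adjacent_add_step: "s \<in> step_vectors \<Longrightarrow> adjacent c (c + s)"
  by (auto simp: adjacent_def step_vectors_def)

text \<open>At height zero the displacement has width \<open>j\<close>. At height one an adjacent
  cell would lie straight above the start, so the first letter must be North and the rest must have
  displacement zero, hence be empty.\<close>

lemma sum_steps_nonzero_and_adjacent:
  assumes w: "set w \<subseteq> step_vectors" "uncancelled w" and j: "0 < j" "j \<le> length w"
  defines "d \<equiv> sum_list (take j w)"
  shows "d \<noteq> 0" and "\<bar>fst d\<bar> + \<bar>snd d\<bar> = 1 \<longleftrightarrow> j = 1"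
proof -
  from j obtain a v k where wv: "w = a # v" and k: "j = Suc k" by (cases w; cases j) auto
  have a: "a \<in> step_vectors" using w by (simp add: wv)
  have nonneg: "0 \<le> snd d" unfolding d_def
    using w set_take_subset[of j w] by (intro snd_sum_steps_nonneg) auto
  have level: "\<bar>fst d\<bar> = int j" if "snd d = 0"
  proof -
    have "snd a = 0 \<and> fst d = int j * fst a"
      using sum_steps_level[of w j] w j that by (simp add: d_def wv)
    with a show ?thesis by (auto simp: step_vectors_def)
  qed
  show "d \<noteq> 0"
    using level j by auto
  have one: "\<bar>fst d\<bar> + \<bar>snd d\<bar> = 1" if "j = 1"
    using that a by (auto simp: d_def wv step_vectors_def)
  have "j = 1" if adj: "\<bar>fst d\<bar> + \<bar>snd d\<bar> = 1"
  proof (cases "snd d = 0")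
    case True
    with adj level show ?thesis by simp
  next
    case False
    with adj nonneg have d: "snd d = 1" "fst d = 0" by auto
    have "snd a \<noteq> 0"
      using sum_steps_next_level[of w j] w j d by (auto simp: d_def wv)
    with a have aN: "a = (0, 1)" by (auto simp: step_vectors_def)
    show ?thesis
    proof (rule ccontr)
      assume "j \<noteq> 1"
      then have "0 < k" by (simp add: k)
      \<comment> \<open>After the first step North, the other \<open>k\<close> letters would form a
        nonempty level walk that returns to its start.\<close>
      moreover have "k \<le> length v" "snd (sum_list (take k v)) = 0" "fst (sum_list (take k v)) = 0"
        using j d by (simp_all add: d_def wv k aN)
      moreover have "hd v \<in> step_vectors"
        using calculation w by (cases v) (auto simp: wv)
      ultimately show False
        using sum_steps_level[of v k] w by (auto simp: wv step_vectors_def)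
    qed
  qed
  with one show "\<bar>fst d\<bar> + \<bar>snd d\<bar> = 1 \<longleftrightarrow> j = 1" by blast
qed

text \<open>The displacement from cell \<open>i\<close> to cell \<open>j\<close> is that of a prefix
  of \<open>drop i w\<close>, which again has no cancelling pair, so the facts about prefixes apply
  to every pair of cells.\<close>

lemma induced_path_path:
  assumes w: "set w \<subseteq> step_vectors" "uncancelled w"
  shows "induced_path (path c w)"
proof -
  have *: "path c w ! i \<noteq> path c w ! j \<and> (adjacent (path c w ! i) (path c w ! j) \<longleftrightarrow> j = Suc i)"
    if "i < j" "j \<le> length w" for i j
  proof -
    have "take j w = take i w @ take (j - i) (drop i w)"
      using that take_add[of i "j - i" w] by simp
    then have eq: "path c w ! j = path c w ! i + sum_list (take (j - i) (drop i w))"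
      using that by (simp add: nth_path add.assoc)
    have "set (drop i w) \<subseteq> step_vectors" using w set_drop_subset[of i w] by auto
    then show ?thesis
      using sum_steps_nonzero_and_adjacent[of "drop i w" "j - i"] w that
      by (auto simp: eq adjacent_def uncancelled_drop)
  qed
  have neq: "path c w ! i \<noteq> path c w ! j" if "i \<noteq> j" "i \<le> length w" "j \<le> length w" for i j
    using *[of i j] *[of j i] that by (metis nat_neq_iff)
  have adj: "adjacent (path c w ! i) (path c w ! j) \<longleftrightarrow> \<bar>int i - int j\<bar> = 1"
    if "i \<le> length w" "j \<le> length w" for i j
  proof (cases i j rule: linorder_cases)
    case less
    then show ?thesis using *[of i j] that by auto
  next
    case equal
    then show ?thesis by (simp add: adjacent_def)
  next
    case greater
    then show ?thesis using *[of j i] that by (auto simp: adjacent_commute)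
  qed
  show ?thesis
    unfolding induced_path_def distinct_conv_nth using neq adj by simp
qed

section \<open>Induced paths are snakes with two traversals\<close>

text \<open>An integer sequence that moves by one and never repeats a value cannot turn back, so the
  first difference \<open>y - x\<close> persists.\<close>

lemma unit_steps_arith_progression:
  fixes ks :: "int list"
  assumes "distinct (x # y # ks)" "successively (\<lambda>a b. \<bar>a - b\<bar> = 1) (x # y # ks)"
    and "i < length (x # y # ks)"
  shows "(x # y # ks) ! i = x + (y - x) * int i"
  using assms
proof (induction ks arbitrary: x y i)
  case Nil
  then show ?case by (cases i) auto
next
  case (Cons z ks)
  show ?case
  proof (cases i)
    case (Suc k)
    have "z - y = y - x" using Cons.prems by (auto simp: abs_if split: if_splits)
    moreover have "(y # z # ks) ! k = y + (z - y) * int k"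
      using Cons.prems Suc by (intro Cons.IH) auto
    ultimately have "(y # z # ks) ! k = y + (y - x) * int k" by metis
    then show ?thesis by (simp add: Suc algebra_simps)
  qed simp
qed

text \<open>Adjacent cells of \<open>cs\<close> have consecutive indices, so a walk without
  repetition runs through the indices in one direction \<open>e\<close>, starting at
  \<open>x\<close>. Both acyclicity and the uniqueness of traversals follow from this.\<close>

lemma induced_path_indices:
  assumes ind: "induced_path cs" and ds: "distinct ds" "set ds \<subseteq> set cs" "successively adjacent ds"
    and len: "2 \<le> length ds"
  obtains ks :: "nat list" and x e :: int
  where "ds = map ((!) cs) ks" "set ks \<subseteq> {..<length cs}" "e = 1 \<or> e = -1"
    "\<And>i. i < length ks \<Longrightarrow> int (ks ! i) = x + e * int i"
proof -
  define ix where "ix d = (SOME i. i < length cs \<and> cs ! i = d)" for d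
  have ix: "ix d < length cs \<and> cs ! ix d = d" if "d \<in> set cs" for d
    unfolding ix_def by (rule someI_ex) (use that in \<open>auto simp: in_set_conv_nth\<close>)
  define ks where "ks = map ix ds"
  have ds_eq: "ds = map ((!) cs) ks"
    using ix ds(2) by (auto simp: ks_def intro!: map_idI[symmetric])
  have sub: "set ks \<subseteq> {..<length cs}" using ix ds(2) by (auto simp: ks_def)
  have dist: "distinct (map int ks)"
    using ds(1) unfolding ds_eq by (simp add: distinct_map)
  have succ: "successively (\<lambda>a b. \<bar>a - b\<bar> = 1) (map int ks)"
    using ds(3) sub ind unfolding ds_eq successively_map induced_path_def
    by (auto elim!: successively_mono)
  obtain a b ls where kab: "map int ks = a # b # ls"
    using len unfolding ks_def by (cases ds; cases "tl ds") auto
  show ?thesis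
  proof (rule that[OF ds_eq sub])
    show "b - a = 1 \<or> b - a = -1" using succ unfolding kab by (auto simp: abs_if split: if_splits)
    fix i assume "i < length ks"
    then show "int (ks ! i) = a + (b - a) * int i"
      using unit_steps_arith_progression[of a b ls i] dist succ unfolding kab
      by (metis kab length_map nth_map)
  qed
qed

text \<open>The closing edge would join indices that differ by \<open>length ks - 1\<close>, which
  is at least two.\<close>

lemma induced_path_no_cycle:
  assumes "induced_path cs"
  shows "\<not> has_cycle (set cs)"
proof
  assume "has_cycle (set cs)"
  then obtain ds where ds: "3 \<le> length ds" "distinct ds" "set ds \<subseteq> set cs"
    "successively adjacent ds" "adjacent (last ds) (hd ds)"
    by (auto simp: has_cycle_def)
  obtain ks x e where ks: "ds = map ((!) cs) ks" "set ks \<subseteq> {..<length cs}" "e = 1 \<or> e = (-1::int)"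
    "\<And>i. i < length ks \<Longrightarrow> int (ks ! i) = x + e * int i"
    by (rule induced_path_indices[OF assms ds(2-4)]) (use ds(1) in auto)
  have len: "3 \<le> length ks" using ds(1) ks(1) by simp
  then have ne: "ks \<noteq> []" by auto
  have "adjacent (cs ! last ks) (cs ! hd ks)" using ds(5) ne by (simp add: ks(1) last_map hd_map)
  moreover have "last ks < length cs" "hd ks < length cs"
    using ks(2) last_in_set[OF ne] hd_in_set[OF ne] by blast+
  ultimately have "\<bar>int (last ks) - int (hd ks)\<bar> = 1" using assms by (auto simp: induced_path_def)
  moreover have "int (last ks) = x + e * int (length ks - 1)"
    using ks(4)[of "length ks - 1"] ne by (simp add: last_conv_nth)
  moreover have "int (hd ks) = x" using ks(4)[of 0] ne by (simp add: hd_conv_nth)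
  ultimately show False using ks(3) len by auto
qed

text \<open>A traversal runs monotonically through all indices, so its direction determines it.
  Lists with fewer than two cells have no direction and are treated separately.\<close>

lemma induced_path_unique:
  assumes ind: "induced_path cs" and ds: "distinct ds" "set ds = set cs" "successively adjacent ds"
  shows "ds = cs \<or> ds = rev cs"
proof -
  have len: "length ds = length cs"
    using ind ds by (metis distinct_card induced_path_def)
  show ?thesis
  proof (cases "2 \<le> length ds")
    case False
    then consider "length ds = 0" | "length ds = 1" by linarith
    then show ?thesis
      by cases (use ds(2) len in \<open>auto simp: length_Suc_conv\<close>)
  next
    case True
    obtain ks x e where ks: "ds = map ((!) cs) ks" "set ks \<subseteq> {..<length cs}" "e = 1 \<or> e = (-1::int)"
      "\<And>i. i < length ks \<Longrightarrow> int (ks ! i) = x + e * int i"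
      by (rule induced_path_indices[OF ind ds(1) _ ds(3) True]) (use ds(2) in auto)
    have lenk: "length ks = length cs" using len ks(1) by simp
    have bnd: "ks ! i < length cs" if "i < length cs" for i
      using ks(2) that lenk by (metis lessThan_iff nth_mem subsetD)
    have pos: "2 \<le> length cs" using True len by simp
    then have "0 < length cs" "length cs - 1 < length cs" by linarith+
  then have ends: "int (ks ! 0) = x" "int (ks ! (length cs - 1)) = x + e * int (length cs - 1)"
      using ks(4)[of 0] ks(4)[of "length cs - 1"] lenk by simp_all
    have bnds: "ks ! 0 < length cs" "ks ! (length cs - 1) < length cs"
      using bnd \<open>0 < length cs\<close> \<open>length cs - 1 < length cs\<close> by blast+
    from ks(3) show ?thesis
    proof
      assume e: "e = 1"
      \<comment> \<open>The first index is nonnegative and the last one,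
        \<open>x + (length cs - 1)\<close>, is below \<open>length cs\<close>; this leaves only one
        value of \<open>x\<close>.\<close>
      with ends bnds have "x = 0" by auto
      then have "ks ! i = i" if "i < length cs" for i using ks(4)[of i] that lenk e by simp
      then have "ds = cs" unfolding ks(1) by (intro nth_equalityI) (auto simp: lenk)
      then show ?thesis ..
    next
      assume e: "e = -1"
      with ends bnds have "x = int (length cs) - 1" by auto
      then have "ks ! i = length cs - Suc i" if "i < length cs" for i
        using ks(4)[of i] that lenk e by auto
      then have "ds = rev cs" unfolding ks(1) by (intro nth_equalityI) (auto simp: lenk rev_nth)
      then show ?thesis ..
    qed
  qed
qed

lemma induced_path_successively_adjacent: "induced_path cs \<Longrightarrow> successively adjacent cs"
  by (auto simp: induced_path_def successively_conv_nth)

lemma edge_connected_path: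
  assumes "successively adjacent cs"
  shows "edge_connected (set cs)"
proof -
  define R where "R = {(x, y). x \<in> set cs \<and> y \<in> set cs \<and> adjacent x y}"
  have "sym R" by (auto simp: R_def sym_def adjacent_commute)
  then have "sym (R\<^sup>*)" by (rule sym_rtrancl)
  have from0: "(cs ! 0, cs ! i) \<in> R\<^sup>*" if "i < length cs" for i
    using that
  proof (induction i)
    case (Suc i)
    have "(cs ! i, cs ! Suc i) \<in> R"
      using assms Suc.prems by (auto simp: R_def successively_conv_nth)
    with Suc show ?case by (meson Suc_lessD rtrancl.rtrancl_into_rtrancl)
  qed simp
  have "(a, b) \<in> R\<^sup>*" if ab: "a \<in> set cs" "b \<in> set cs" for a b
  proof -
    have "(cs ! 0, a) \<in> R\<^sup>*" "(cs ! 0, b) \<in> R\<^sup>*"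
      using from0 ab by (auto simp: in_set_conv_nth)
    then show ?thesis using \<open>sym (R\<^sup>*)\<close> by (meson rtrancl_trans symE)
  qed
  then show ?thesis by (simp add: edge_connected_def R_def)
qed

lemma induced_path_degree:
  assumes ind: "induced_path cs" and a: "a \<in> set cs"
  shows "degree_in (set cs) a \<le> 2"
proof -
  obtain i where i: "i < length cs" "a = cs ! i" using a by (auto simp: in_set_conv_nth)
  \<comment> \<open>At the two ends, \<open>i - 1\<close> truncates to \<open>i\<close> or
    \<open>Suc i\<close> is out of range. Both are harmless, since only an inclusion in a set of at
    most two cells is claimed.\<close>
  have "{b \<in> set cs. adjacent a b} \<subseteq> {cs ! (i - 1), cs ! Suc i}"
  proof
    fix b assume "b \<in> {b \<in> set cs. adjacent a b}"
    then obtain j where j: "j < length cs" "b = cs ! j" "adjacent a b"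
      by (auto simp: in_set_conv_nth)
    then have "\<bar>int i - int j\<bar> = 1" using ind i by (auto simp: induced_path_def)
    then have "j = i - 1 \<or> j = Suc i" by auto
    with j show "b \<in> {cs ! (i - 1), cs ! Suc i}" by auto
  qed
  then have "degree_in (set cs) a \<le> card {cs ! (i - 1), cs ! Suc i}"
    unfolding degree_in_def by (intro card_mono) auto
  also have "\<dots> \<le> 2" by (simp add: card_insert_if)
  finally show ?thesis .
qed

lemma induced_path_snake: "induced_path cs \<Longrightarrow> snake (set cs)"
  by (simp add: snake_def polyomino_def edge_connected_path induced_path_successively_adjacent
      induced_path_no_cycle induced_path_degree)

section \<open>Correspondence between partially directed snakes and words\<close>

lemma pds_of_word:
  assumes "w \<in> words m"
  shows "partially_directed_snake (set (path c w))" "card (set (path c w)) = Suc m"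
proof -
  have w: "set w \<subseteq> step_vectors" "uncancelled w" "length w = m"
    using assms by (auto simp: words_def)
  note ind = induced_path_path[OF w(1,2), of c]
  then have "distinct (path c w)" by (simp add: induced_path_def)
  then show "card (set (path c w)) = Suc m" by (simp add: distinct_card w)
  show "partially_directed_snake (set (path c w))"
    unfolding partially_directed_snake_def
    using induced_path_snake[OF ind] \<open>distinct (path c w)\<close> successively_path[of c w] w by blast
qed

text \<open>Distinctness excludes cancelling neighbours, which would revisit a cell; acyclicity
  excludes cancelling letters at distance two.\<close>

lemma uncancelled_if_acyclic:
  assumes "distinct (path c w)" "set w \<subseteq> step_vectors" "\<not> has_cycle (set (path c w))"
  shows "uncancelled w"
  using assms
proof (induction c w rule: path.induct)
  case (2 c s w)
  have "uncancelled w"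
    using 2 by (auto simp: has_cycle_def)
  moreover have "- s \<notin> set (take 2 w)"
  proof
    assume s: "- s \<in> set (take 2 w)"
    then obtain a v where w: "w = a # v" by (cases w) auto
    have c_notin: "c \<notin> set (path (c + s) w)" using "2.prems"(1) by simp
    have "a \<noteq> - s"
    proof
      assume "a = - s"
      then have "c \<in> set (path (c + s) w)" by (cases v) (auto simp: w)
      with c_notin show False by simp
    qed
    with s w obtain u where v: "v = - s # u" by (cases v) auto
    \<comment> \<open>The steps \<open>s\<close>, \<open>a\<close>, \<open>- s\<close> run through a 2 by 2 square.\<close>
    let ?q = "[c, c + s, c + s + a, c + a]"
    have sub: "set ?q \<subseteq> set (path c (s # w))" by (cases u) (auto simp: w v)
    have dist: "distinct ?q" using "2.prems"(1) by (cases u) (auto simp: w v)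
    have steps: "adjacent c (c + s)" "adjacent (c + s) (c + s + a)" "adjacent c (c + a)"
      "adjacent (c + a) (c + a + s)"
      using "2.prems"(2) by (auto simp: w intro!: adjacent_add_step)
    then have "has_cycle (set (path c (s # w)))"
      unfolding has_cycle_def using sub dist
      by (intro exI[of _ ?q]) (auto simp: adjacent_commute add_ac)
    with 2 show False by simp
  qed
  ultimately show ?case by simp
qed simp

lemma word_of_pds:
  assumes "partially_directed_snake S" "card S = Suc m"
  shows "\<exists>c. \<exists>w\<in>words m. S = set (path c w)"
proof -
  obtain cs where cs: "distinct cs" "set cs = S" "successively north_east_west_step cs"
    "\<not> has_cycle S"
    using assms(1) by (auto simp: partially_directed_snake_def snake_def)
  have len: "length cs = Suc m" using cs assms(2) by (metis distinct_card)
  then obtain w where w: "cs = path (hd cs) w" using ex_path[of cs] by force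
  have "length w = m" using len w by (metis length_path old.nat.inject)
  moreover have sv: "set w \<subseteq> step_vectors" using cs(3) w successively_path by metis
  moreover have "uncancelled w" using uncancelled_if_acyclic cs sv w by metis
  ultimately have "w \<in> words m" by (simp add: words_def)
  then show ?thesis using w cs(2) by metis
qed

section \<open>Translation classes and the one coincidence between words\<close>

lemma equiv_translation_rel: "equiv UNIV translation_rel"
proof (rule equivI)
  show "refl translation_rel"
  proof (rule refl_onI)
    fix S :: "cell set"
    have "S = (+) 0 ` S" by simp
    then show "(S, S) \<in> translation_rel" unfolding translation_rel_def by blast
  qed
  show "sym translation_rel"
  proof (rule symI)
    fix S T assume "(S, T) \<in> translation_rel"
    then obtain v where "T = (+) v ` S" by (auto simp: translation_rel_def)
    then have "S = (+) (- v) ` T" by (simp add: image_image)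
    then show "(T, S) \<in> translation_rel" unfolding translation_rel_def by blast
  qed
  show "trans translation_rel"
  proof (rule transI)
    fix S T U assume "(S, T) \<in> translation_rel" "(T, U) \<in> translation_rel"
    then obtain u v where "T = (+) u ` S" "U = (+) v ` T" by (auto simp: translation_rel_def)
    then have "U = (+) (v + u) ` S" by (simp add: image_image add.assoc)
    then show "(S, U) \<in> translation_rel" unfolding translation_rel_def by blast
  qed
qed auto

definition snake_class :: "cell list \<Rightarrow> cell set set" where
  "snake_class w = translation_rel `` {set (path 0 w)}"

lemma snake_class_path: "translation_rel `` {set (path c w)} = snake_class w"
proof -
  have "set (path c w) = (+) c ` set (path 0 w)" using path_translate[of c 0 w] by simp
  then have "(set (path 0 w), set (path c w)) \<in> translation_rel"
    unfolding translation_rel_def by blast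
  then show ?thesis
    unfolding snake_class_def using equiv_class_eq[OF equiv_translation_rel] by blast
qed

lemma quotient_eq_snake_classes:
  "{S. partially_directed_snake S \<and> card S = Suc m} // translation_rel = snake_class ` words m"
    (is "?P // _ = _")
proof
  show "?P // translation_rel \<subseteq> snake_class ` words m"
  proof
    fix X assume "X \<in> ?P // translation_rel"
    then obtain S where S: "S \<in> ?P" "X = translation_rel `` {S}" by (rule quotientE)
    then obtain c w where "w \<in> words m" "S = set (path c w)" using word_of_pds by blast
    then show "X \<in> snake_class ` words m" using S(2) snake_class_path by blast
  qed
  show "snake_class ` words m \<subseteq> ?P // translation_rel"
    unfolding snake_class_def using pds_of_word by (blast intro: quotientI)
qed

lemma uncancelled_horizontal:
  assumes "uncancelled w" "set w \<subseteq> {(1, 0), (-1, 0)}"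
  shows "w = replicate (length w) (1, 0) \<or> w = replicate (length w) (-1, 0)"
  using assms
proof (induction w)
  case (Cons a w)
  then have "w = replicate (length w) (1, 0) \<or> w = replicate (length w) (-1, 0)" by auto
  with Cons.prems show ?case by (cases w) auto
qed simp

text \<open>Reversal turns a North step into a South step, which is not allowed.\<close>

lemma successively_rev_imp_horizontal:
  assumes "successively north_east_west_step (path c w)"
    and "successively north_east_west_step (rev (path c w))"
  shows "set w \<subseteq> {(1, 0), (-1, 0)}"
  using assms unfolding successively_rev
  by (induction c w rule: path.induct)
     (auto simp: successively_Cons north_east_west_step_def)

text \<open>After a translation both words traverse the same induced path, so the traversals agree
  or are reverse to each other. Agreement gives equal words; reversal forces both words to be
  horizontal, hence constant.\<close>

lemma snake_class_eq_imp:
  assumes w: "w \<in> words m" and w': "w' \<in> words m" and eq: "snake_class w = snake_class w'"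
  shows "w = w' \<or> (w = replicate m (1, 0) \<and> w' = replicate m (-1, 0)) \<or>
         (w = replicate m (-1, 0) \<and> w' = replicate m (1, 0))"
proof -
  have "(set (path 0 w), set (path 0 w')) \<in> translation_rel"
    using eq_equiv_class_iff[OF equiv_translation_rel, of "set (path 0 w)" "set (path 0 w')"]
      eq by (simp add: snake_class_def)
  then obtain c where "set (path 0 w') = (+) c ` set (path 0 w)"
    by (auto simp: translation_rel_def)
  then have sets: "set (path 0 w') = set (path c w)" using path_translate[of c 0 w] by simp
  have ww: "set w \<subseteq> step_vectors" "uncancelled w" "length w = m"
      "set w' \<subseteq> step_vectors" "uncancelled w'" "length w' = m"
    using w w' by (auto simp: words_def)
  have ind: "induced_path (path c w)" "induced_path (path 0 w')"
    using ww by (auto intro: induced_path_path)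
  from induced_path_unique[OF ind(1) _ sets] ind(2)
  have "path 0 w' = path c w \<or> path 0 w' = rev (path c w)"
    by (simp add: induced_path_successively_adjacent) (simp add: induced_path_def)
  then show ?thesis
  proof
    assume "path 0 w' = path c w"
    then show ?thesis using path_inject by metis
  next
    assume rev: "path 0 w' = rev (path c w)"
    then have rev': "path c w = rev (path 0 w')" by simp
    have su: "successively north_east_west_step (path c w)"
         "successively north_east_west_step (path 0 w')"
      using ww by (simp_all add: successively_path)
    have "set w \<subseteq> {(1, 0), (-1, 0)}"
      using su rev by (intro successively_rev_imp_horizontal[of c]) simp_all
    moreover have "set w' \<subseteq> {(1, 0), (-1, 0)}"
      using su rev' by (intro successively_rev_imp_horizontal[of 0]) simp_all
    ultimately show ?thesis using uncancelled_horizontal ww by metis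
  qed
qed

lemma path_snoc: "path d (u @ [t]) = path d u @ [d + sum_list u + t]"
  by (induction d u rule: path.induct) (auto simp: add.assoc)

text \<open>A straight path read backwards starts at its other end and uses the opposite step; for
  horizontal steps this identifies the two words of a bar.\<close>

lemma path_replicate_opposite:
  "rev (path c (replicate m s)) = path (c + sum_list (replicate m s)) (replicate m (- s))"
proof (induction m arbitrary: c)
  case (Suc m)
  define d where "d = c + sum_list (replicate (Suc m) s)"
  have "sum_list (replicate m (- s)) = - sum_list (replicate m s)"
    by (induction m) simp_all
  then have "d + sum_list (replicate m (- s)) + - s = c" by (simp add: d_def)
  then have "path d (replicate m (- s) @ [- s]) = path d (replicate m (- s)) @ [c]"
    by (simp only: path_snoc)
  moreover have "rev (path (c + s) (replicate m s)) = path d (replicate m (- s))"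
    by (simp add: Suc d_def add.assoc)
  ultimately have "rev (path c (replicate (Suc m) s)) = path d (replicate (Suc m) (- s))"
    by (simp add: replicate_append_same)
  then show ?case by (simp only: d_def)
qed simp

lemma replicate_in_words:
  assumes "s \<in> step_vectors"
  shows "replicate m s \<in> words m"
proof -
  have "s \<noteq> - s" using assms by (auto simp: step_vectors_def)
  then have "uncancelled (replicate m s)"
    by (induction m) (auto dest: in_set_takeD)
  then show ?thesis using assms by (auto simp: words_def)
qed

lemma finite_words: "finite (words m)"
  by (rule finite_subset[OF _ finite_lists_length_eq[of step_vectors m]])
     (auto simp: words_def step_vectors_def)

text \<open>The only collision of \<open>snake_class\<close> is between the all-East and the
  all-West word. These differ only for \<open>0 < m\<close>; for \<open>m = 0\<close> both are the
  empty word.\<close>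

lemma card_snake_classes:
  assumes "0 < m"
  shows "card (snake_class ` words m) = card (words m) - 1"
proof -
  let ?E = "replicate m (1, 0) :: cell list" and ?W = "replicate m (-1, 0) :: cell list"
  have E: "?E \<in> words m" and W: "?W \<in> words m"
    by (auto intro!: replicate_in_words simp: step_vectors_def)
  have neq: "?E \<noteq> ?W" using assms by (simp add: replicate_eq_replicate)
  have "set (path 0 ?E) = set (path (0 + sum_list ?E) ?W)"
    using path_replicate_opposite[of 0 m "(1, 0)"] by (metis set_rev uminus_Pair minus_zero)
  then have "snake_class ?E = snake_class ?W"
    using snake_class_path by metis
  \<comment> \<open>The class of \<open>?W\<close> is also that of \<open>?E\<close>, so discarding
    \<open>?W\<close> keeps the image and makes the map injective.\<close>
  then have "snake_class ?W \<in> snake_class ` (words m - {?W})"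
    using E neq by (intro image_eqI[of _ _ ?E]) simp_all
  moreover have "words m = insert ?W (words m - {?W})" using W by blast
  then have "snake_class ` words m = insert (snake_class ?W) (snake_class ` (words m - {?W}))"
    by (metis image_insert)
  ultimately have "snake_class ` words m = snake_class ` (words m - {?W})"
    by (simp only: insert_absorb)
  moreover have "inj_on snake_class (words m - {?W})"
  proof (rule inj_onI)
    fix v w assume "v \<in> words m - {?W}" "w \<in> words m - {?W}" "snake_class v = snake_class w"
    then show "v = w" using snake_class_eq_imp[of v m w] by blast
  qed
  ultimately show ?thesis
    using W finite_words by (simp add: card_image)
qed

section \<open>Recurrence for the number of words\<close>

definition words_starting :: "cell \<Rightarrow> nat \<Rightarrow> cell list set" where
  "words_starting a m = {w \<in> words m. a \<in> set (take 1 w)}"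

text \<open>These are the words in front of which the letter \<open>- a\<close> may not be
  put.\<close>

definition words_soon :: "cell \<Rightarrow> nat \<Rightarrow> cell list set" where
  "words_soon a m = {w \<in> words m. a \<in> set (take 2 w)}"

lemma Cons_in_words [simp]:
  "a # w \<in> words (Suc m) \<longleftrightarrow> a \<in> step_vectors \<and> w \<in> words m \<and> - a \<notin> set (take 2 w)"
  by (auto simp: words_def)

lemma words_starting_Suc:
  assumes "a \<in> step_vectors"
  shows "words_starting a (Suc m) = (#) a ` (words m - words_soon (- a) m)"
proof -
  have "w \<in> words_starting a (Suc m) \<longleftrightarrow> w \<in> (#) a ` (words m - words_soon (- a) m)" for w
    using assms by (cases w) (auto simp: words_starting_def words_soon_def words_def)
  then show ?thesis by blast
qed

text \<open>Removing the leading \<open>a\<close> leaves any word in which \<open>- a\<close> does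
  not come too soon. The sum form avoids subtraction in \<open>nat\<close>.\<close>

lemma card_words_starting_Suc:
  assumes "a \<in> step_vectors"
  shows "card (words_starting a (Suc m)) + card (words_soon (- a) m) = card (words m)"
proof -
  have sub: "words_soon (- a) m \<subseteq> words m" by (auto simp: words_soon_def)
  have "card (words_starting a (Suc m)) = card (words m - words_soon (- a) m)"
    unfolding words_starting_Suc[OF assms] by (rule card_image) simp
  also have "\<dots> = card (words m) - card (words_soon (- a) m)"
    using sub finite_words by (meson card_Diff_subset finite_subset)
  finally show ?thesis
    using card_mono[OF finite_words sub] by simp
qed

text \<open>South is not a step, so North can precede every word.\<close>

lemma card_words_starting_north: "card (words_starting (0, 1) (Suc m)) = card (words m)"
proof -
  have "words_soon (0, -1) m = {}"
    by (auto simp: words_soon_def words_def step_vectors_def dest!: in_set_takeD)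
  then show ?thesis
    using card_words_starting_Suc[of "(0, 1)" m] by (simp add: step_vectors_def)
qed

lemma card_words_Suc:
  "card (words (Suc m)) =
     card (words m) + card (words_starting (1, 0) (Suc m)) + card (words_starting (-1, 0) (Suc m))"
proof -
  have "w \<in> words (Suc m) \<longleftrightarrow> w \<in> words_starting (0, 1) (Suc m) \<union>
      (words_starting (1, 0) (Suc m) \<union> words_starting (-1, 0) (Suc m))" for w
    by (cases w) (auto simp: words_starting_def words_def step_vectors_def)
  then have "words (Suc m) = words_starting (0, 1) (Suc m) \<union>
      (words_starting (1, 0) (Suc m) \<union> words_starting (-1, 0) (Suc m))" by blast
  moreover have "finite (words_starting a k)" for a k
    by (simp add: words_starting_def finite_words)
  moreover have "words_starting a k \<inter> words_starting b k = {}" if "a \<noteq> b" for a b k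
  proof -
    have False if "w \<in> words_starting a k" "w \<in> words_starting b k" for w
      using that \<open>a \<noteq> b\<close> by (cases w) (auto simp: words_starting_def)
    then show ?thesis by blast
  qed
  ultimately show ?thesis
    by (simp add: card_Un_disjoint Int_Un_distrib card_words_starting_north)
qed

text \<open>If the horizontal letter \<open>a\<close> is second but not first, the first letter is
  neither \<open>a\<close> nor \<open>- a\<close>, so it is North, and removing it leaves a word
  that starts with \<open>a\<close>.\<close>

lemma card_words_soon_Suc:
  assumes a: "a \<in> step_vectors" "a \<noteq> (0, 1)"
  shows "card (words_soon a (Suc m)) = card (words_starting a (Suc m)) + card (words_starting a m)"
proof -
  have "w \<in> words_soon a (Suc m) \<longleftrightarrow>
      w \<in> words_starting a (Suc m) \<union> (#) (0, 1) ` words_starting a m" for w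
  proof (cases w)
    case (Cons b v)
    show ?thesis
    proof (cases "b = a")
      case True
      with a(2) show ?thesis
        unfolding Cons by (auto simp: words_soon_def words_starting_def simp del: Cons_in_words)
    next
      case False
      have "a \<in> set (take 1 v) \<longleftrightarrow> b = (0, 1) \<and> a \<in> set (take 1 v)"
        if "b # v \<in> words (Suc m)"
      proof -
        have "b = (0, 1)" if "a \<in> set (take 1 v)"
        proof -
          have "set (take 1 v) \<subseteq> set (take 2 v)" by (rule set_take_subset_set_take) simp
          then have "- b \<noteq> a" using that \<open>b # v \<in> words (Suc m)\<close> by auto
          moreover have "b \<in> step_vectors" using \<open>b # v \<in> words (Suc m)\<close> by simp
          ultimately show ?thesis
            using False a by (elim step_vectors_cases) simp_all
        qed
        then show ?thesis by blast
      qed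
      moreover have "(0, 1) # v \<in> words (Suc m) \<longleftrightarrow> v \<in> words m"
        unfolding Cons_in_words by (auto simp: step_vectors_def words_def dest!: in_set_takeD)
      ultimately show ?thesis
        using False Cons
        by (auto simp: words_soon_def words_starting_def numeral_2_eq_2 simp del: Cons_in_words)
    qed
  qed (auto simp: words_soon_def words_starting_def)
  then have "words_soon a (Suc m) = words_starting a (Suc m) \<union> (#) (0, 1) ` words_starting a m"
    by blast
  moreover have "words_starting a (Suc m) \<inter> (#) (0, 1) ` words_starting a m = {}"
    using a(2) by (auto simp: words_starting_def)
  moreover have "finite (words_starting a k)" for k
    by (simp add: words_starting_def finite_words)
  ultimately show ?thesis
    by (simp add: card_Un_disjoint card_image)
qed

lemma words_0: "words 0 = {[]}"
  by (auto simp: words_def)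

lemma card_words_0: "card (words 0) = 1"
  by (simp add: words_0)

text \<open>Let \<open>g k\<close> count all words of length \<open>k\<close> and \<open>h k\<close>
  those starting with East or West. Then \<open>g (k + 1) = g k + h (k + 1)\<close> and
  \<open>h (m + 3) = 2 * g (m + 2) - h (m + 2) - h (m + 1)\<close>. Since
  \<open>h (m + 2) + h (m + 1)\<close> telescopes to \<open>g (m + 2) - g m\<close>, the numbers
  \<open>h\<close> can be eliminated.\<close>

lemma card_words_small: "card (words 1) = 3" "card (words 2) = 7"
  and card_words_rec: "card (words (m + 3)) = 2 * card (words (m + 2)) + card (words m)"
proof -
  have start: "card (words_starting (1, 0) (Suc k)) + card (words_soon (-1, 0) k) = card (words k)"
    "card (words_starting (-1, 0) (Suc k)) + card (words_soon (1, 0) k) = card (words k)" for k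
    using card_words_starting_Suc[of "(1, 0)" k] card_words_starting_Suc[of "(-1, 0)" k]
    by (simp_all add: step_vectors_def)
  note soon = card_words_soon_Suc[of "(1, 0)", simplified step_vectors_def, simplified]
    card_words_soon_Suc[of "(-1, 0)", simplified step_vectors_def, simplified]
  have zero: "words_starting a 0 = {}" "words_soon a 0 = {}" for a
    by (simp_all add: words_starting_def words_soon_def words_0)
  show one: "card (words 1) = 3"
    using card_words_Suc[of 0] start[of 0] by (simp add: zero card_words_0)
  show "card (words 2) = 7"
    using one card_words_Suc[of 0] card_words_Suc[of 1] start[of 0] start[of 1] soon[of 0]
    by (simp add: zero card_words_0 numeral_2_eq_2)
  show "card (words (m + 3)) = 2 * card (words (m + 2)) + card (words m)"
    using card_words_Suc[of m] card_words_Suc[of "m + 1"] card_words_Suc[of "m + 2"]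
      start[of "m + 2"] soon[of "m + 1"]
    by (simp add: numeral_eq_Suc)
qed

section \<open>Initial values and the generating function\<close>

lemma pds2D_0: "pds2D 0 = 1"
proof -
  have "snake {}"
    by (simp add: snake_def polyomino_def edge_connected_def has_cycle_def)
  then have "{S. partially_directed_snake S \<and> card S = 0} = {{}}"
    by (auto simp: partially_directed_snake_def snake_def polyomino_def)
  moreover have "translation_rel `` {{}} = {{}}"
    by (auto simp: translation_rel_def)
  ultimately show ?thesis by (simp add: pds2D_def quotient_def)
qed

lemma pds2D_Suc: "pds2D (Suc m) = card (snake_class ` words m)"
  by (simp add: pds2D_def quotient_eq_snake_classes)

lemma pds2D_1: "pds2D 1 = 1"
  by (simp add: pds2D_Suc words_0)

text \<open>A snake of \<open>m + 2\<close> cells has \<open>m + 1\<close> steps, and the horizontal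
  bar is counted by two words.\<close>

lemma pds2D_eq_card_words: "pds2D (m + 2) = card (words (m + 1)) - 1"
  using card_snake_classes[of "m + 1"] by (simp add: pds2D_Suc)

lemma card_words_pos: "0 < card (words m)"
  using replicate_in_words[of "(0, 1)" m] finite_words
  by (auto simp: step_vectors_def card_gt_0_iff)

lemma of_nat_pds2D:
  "(of_nat (pds2D (m + 2)) :: 'a :: ring_1) = of_nat (card (words (m + 1))) - 1"
  using card_words_pos[of "m + 1"] by (simp only: pds2D_eq_card_words) (simp add: of_nat_diff)

text \<open>Multiplication by the denominator turns the claim into a linear recurrence for the
  coefficients. The recurrence covers all coefficients from index 6 on; the first six give the
  numerator.\<close>

lemma pds2D_fps:
  "Abs_fps (\<lambda>n. of_nat (pds2D n) :: rat) =
     (fps_X ^ 5 + fps_X ^ 3 + fps_X ^ 2 - 2 * fps_X + 1) /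
     ((1 - fps_X) * (1 - 2 * fps_X - fps_X ^ 3))"
proof -
  define p where "p = (\<lambda>n. of_nat (pds2D n) :: rat)"
  define F where "F = Abs_fps p"
  define D where "D = (1 - fps_X) * (1 - 2 * fps_X - fps_X ^ 3 :: rat fps)"
  have p01: "p 0 = 1" "p 1 = 1" by (simp_all only: p_def pds2D_0 pds2D_1 of_nat_1)
  have p_words: "p (m + 2) = of_nat (card (words (m + 1))) - 1" for m
    unfolding p_def by (rule of_nat_pds2D)
  \<comment> \<open>The recurrence of the words holds for \<open>p + 1\<close>; the shift by one
    leaves the constant 2.\<close>
  have p_rec: "p (m + 5) = 2 * p (m + 4) + p (m + 2) + 2" for m
    using p_words[of m] p_words[of "m + 2"] p_words[of "m + 3"] card_words_rec[of "m + 1"]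
    by (simp add: numeral_eq_Suc)
  \<comment> \<open>The difference of two consecutive instances removes the constant, which
    corresponds to the factor \<open>1 - fps_X\<close> of \<open>D\<close>.\<close>
  have p_rec': "p (m + 6) - 3 * p (m + 5) + 2 * p (m + 4) - p (m + 3) + p (m + 2) = 0" for m
    using p_rec[of m] p_rec[of "m + 1"] by (simp add: numeral_eq_Suc)
  have p234: "p 2 = 2" "p 3 = 6" "p 4 = 14"
    using p_words[of 0] p_words[of 1] p_words[of 2] card_words_rec[of 0] card_words_small card_words_0
    by (simp_all add: numeral_eq_Suc)
  have "F * D = F - 3 * (fps_X * F) + 2 * (fps_X ^ 2 * F) - fps_X ^ 3 * F + fps_X ^ 4 * F"
    by (simp add: D_def algebra_simps power_numeral_reduce)
  also have "\<dots> = fps_X ^ 5 + fps_X ^ 3 + fps_X ^ 2 - 2 * fps_X + 1"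
  proof (rule fps_ext)
    fix n :: nat
    have "n = 0 \<or> n = 1 \<or> n = 2 \<or> n = 3 \<or> n = 4 \<or> n = 5 \<or> n = (n - 6) + 6" by arith
    then consider "n = 0" | "n = 1" | "n = 2" | "n = 3" | "n = 4" | "n = 5" | m where "n = m + 6"
      by blast
    then show "fps_nth (F - 3 * (fps_X * F) + 2 * (fps_X ^ 2 * F)
          - fps_X ^ 3 * F + fps_X ^ 4 * F) n =
        fps_nth (fps_X ^ 5 + fps_X ^ 3 + fps_X ^ 2 - 2 * fps_X + 1) n"
    proof cases
      case (7 m)
      then show ?thesis using p_rec'[of m]
        by (simp add: F_def fps_X_power_mult_nth fps_X_mult_nth fps_X_nth fps_X_power_nth
            numeral_fps_const add.commute)
    qed (use p01 p234 p_rec[of 0] in \<open>simp_all add: F_def fps_X_power_mult_nth fps_X_mult_nth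
          fps_X_nth fps_X_power_nth numeral_fps_const flip: numeral_2_eq_2\<close>)
  qed
  finally have "F * D = fps_X ^ 5 + fps_X ^ 3 + fps_X ^ 2 - 2 * fps_X + 1"
    .
  moreover have "D \<noteq> 0"
  proof
    assume "D = 0"
    then have "fps_nth D 0 = 0" by simp
    then show False by (simp add: D_def)
  qed
  ultimately have "F = (fps_X ^ 5 + fps_X ^ 3 + fps_X ^ 2 - 2 * fps_X + 1) / D"
    by (metis nonzero_mult_div_cancel_right)
  then show ?thesis unfolding F_def D_def p_def .
qed

section \<open>Roots of the cubic and the closed form\<close>

text \<open>The hypotheses are the Vieta relations of
  \<open>\<alpha> ^ 3 + 2 * \<alpha> - 1\<close>. A double root \<open>a\<close> would satisfy both
  \<open>3 * a ^ 2 = - 2\<close> and \<open>a = 3 / 4\<close>. The relations are invariant under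
  cyclic shifts, so the one inequality yields all three.\<close>

lemma cubic_roots_distinct:
  fixes a b c :: complex
  assumes "a + b + c = 0" "a * b + b * c + c * a = 2" "a * b * c = 1"
  shows "a \<noteq> b"
proof
  assume "a = b"
  with assms(1) have c: "c = - 2 * a" by (simp add: eq_neg_iff_add_eq_0 algebra_simps)
  have "a * b + b * c + c * a = - (3 * a ^ 2)"
    using \<open>a = b\<close> c by (simp add: power2_eq_square algebra_simps)
  with assms(2) have sq: "3 * a ^ 2 = - 2" by (metis minus_minus)
  have "- 2 * a ^ 2 * a = 1"
    using assms(3) \<open>a = b\<close> c by (simp add: power2_eq_square mult_ac)
  moreover have "a ^ 2 = - 2 / 3" using sq by (simp add: field_simps)
  ultimately have "a = 3 / 4" by (simp add: field_simps)
  with sq show False by (simp add: power2_eq_square)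
qed

lemma cubic_roots:
  obtains a b c :: complex
  where "{\<alpha>. 1 - 2 * \<alpha> - \<alpha> ^ 3 = 0} = {a, b, c}" "a \<noteq> b" "a \<noteq> c" "b \<noteq> c"
    "a + b + c = 0" "a * b + b * c + c * a = 2" "a * b * c = 1"
proof -
  \<comment> \<open>The left side takes the values 0 and 3 at the ends of the interval.\<close>
  have "\<exists>r\<ge>0. r \<le> 1 \<and> r ^ 3 + 2 * r = (1 :: real)"
    by (rule IVT') (auto intro!: continuous_intros)
  then obtain r :: real where r: "r ^ 3 + 2 * r = 1" by blast
  define a :: complex where "a = of_real r"
  have a: "a ^ 3 = 1 - 2 * a"
    using arg_cong[OF r, of complex_of_real] by (simp add: a_def algebra_simps)
  \<comment> \<open>With the real root \<open>a\<close> split off, the other two are the roots of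
    \<open>x ^ 2 + a * x + (a ^ 2 + 2)\<close>, whose discriminant is
    \<open>- 3 * a ^ 2 - 8\<close>.\<close>
  define d where "d = csqrt (- 3 * a ^ 2 - 8)"
  have d: "d ^ 2 = - 3 * a ^ 2 - 8" by (simp add: d_def)
  define b c where "b = (- a + d) / 2" and "c = (- a - d) / 2"
  have sum: "a + b + c = 0" by (simp add: b_def c_def field_simps)
  have bc: "b * c = a ^ 2 + 2"
  proof -
    have "4 * (b * c) = a ^ 2 - d ^ 2" by (simp add: b_def c_def power2_eq_square field_simps)
    also have "\<dots> = 4 * (a ^ 2 + 2)" by (simp add: d)
    finally show ?thesis by (simp only: mult_cancel_left) simp
  qed
  have pairs: "a * b + b * c + c * a = 2"
  proof -
    have "a * b + b * c + c * a = b * c + a * ((a + b + c) - a)" by (simp add: algebra_simps)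
    then show ?thesis by (simp add: sum bc power2_eq_square)
  qed
  have prod: "a * b * c = 1"
  proof -
    have "a * b * c = a ^ 3 + 2 * a"
      by (simp add: mult.assoc bc) (simp add: algebra_simps power2_eq_square power3_eq_cube)
    then show ?thesis by (simp add: a)
  qed
  have "1 - 2 * x - x ^ 3 = - (x - a) * (x - b) * (x - c)" for x
  proof -
    have "- (x - a) * (x - b) * (x - c) =
        a * b * c - (a * b + b * c + c * a) * x + (a + b + c) * x ^ 2 - x ^ 3"
      by (simp add: algebra_simps power2_eq_square power3_eq_cube)
    then show ?thesis by (simp add: sum pairs prod)
  qed
  then have roots: "{\<alpha>. 1 - 2 * \<alpha> - \<alpha> ^ 3 = 0} = {a, b, c}" by auto
  have "a \<noteq> b" "b \<noteq> c" "c \<noteq> a"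
    using cubic_roots_distinct[of a b c] cubic_roots_distinct[of b c a] cubic_roots_distinct[of c a b]
      sum pairs prod by (simp_all add: add_ac mult_ac)
  then show thesis using that[OF roots] sum pairs prod by blast
qed

text \<open>Both sides satisfy the same recurrence of order three, so three initial values suffice.
  On the left they come from power sums of the inverse roots. The number 59 is the absolute value of
  the discriminant of the cubic.\<close>

lemma card_words_roots:
  "(\<Sum>\<alpha> | 1 - 2 * \<alpha> - \<alpha> ^ 3 = (0 :: complex).
      (13 * inverse \<alpha> + 11 - 5 * \<alpha>) * inverse \<alpha> ^ (m + 2)) = 59 * of_nat (card (words (m + 1)))"
proof -
  obtain a b c :: complex where roots: "{\<alpha>. 1 - 2 * \<alpha> - \<alpha> ^ 3 = 0} = {a, b, c}"
    and dist: "a \<noteq> b" "a \<noteq> c" "b \<noteq> c"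
    and sym: "a + b + c = 0" "a * b + b * c + c * a = 2" "a * b * c = 1"
    by (rule cubic_roots)
  define x y z where "x = inverse a" and "y = inverse b" and "z = inverse c"
  have nz: "a \<noteq> 0" "b \<noteq> 0" "c \<noteq> 0" using sym(3) by auto
  have cube: "inverse r ^ 3 = 2 * inverse r ^ 2 + 1" if "r \<in> {a, b, c}" for r
  proof -
    have "r \<noteq> 0" "1 = 2 * r + r ^ 3" using that nz roots by (auto simp: algebra_simps)
    then show ?thesis by (simp add: field_simps power2_eq_square power3_eq_cube)
  qed
  then have xyz3: "x ^ 3 = 2 * x ^ 2 + 1" "y ^ 3 = 2 * y ^ 2 + 1" "z ^ 3 = 2 * z ^ 2 + 1"
    by (simp_all add: x_def y_def z_def)
  \<comment> \<open>Since the product of the roots is 1, each inverse is the product of the other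
    two roots, which makes the power sums accessible to the Vieta relations.\<close>
  have xyz: "x = b * c" "y = a * c" "z = a * b"
    using nz sym(3) by (simp_all add: x_def y_def z_def field_simps)
  define s where "s k = x ^ k + y ^ k + z ^ k" for k
  have s_rec: "s (k + 3) = 2 * s (k + 2) + s k" for k
    by (simp only: s_def power_add xyz3) (simp add: algebra_simps)
  have s1: "s 1 = 2" using sym(2) by (simp add: s_def xyz algebra_simps)
  \<comment> \<open>Here \<open>x * y + y * z + z * x\<close> equals
    \<open>a * b * c * (a + b + c)\<close>, which vanishes.\<close>
  have "s 2 = (x + y + z) ^ 2 - 2 * (a * b * c) * (a + b + c)"
    by (simp add: s_def xyz algebra_simps power2_eq_square)
  then have s2: "s 2 = 4" using s1 sym by (simp add: s_def)
  have s0: "s 0 = 3" by (simp add: s_def)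
  have s3: "s 3 = 11" using s_rec[of 0] s2 s0 by (simp add: numeral_eq_Suc)
  have s4: "s 4 = 24" using s_rec[of 1] s3 s1 by (simp add: numeral_eq_Suc)
  have s5: "s 5 = 52" using s_rec[of 2] s4 s2 by simp
  \<comment> \<open>This is the sum over the roots with the factor in parentheses multiplied out;
    \<open>- 5 * \<alpha>\<close> lowers the exponent \<open>k + 2\<close> by one and
    \<open>13 * inverse \<alpha>\<close> raises it by one.\<close>
  define t where "t k = 13 * s (k + 3) + 11 * s (k + 2) - 5 * s (k + 1)" for k
  have t_rec: "t (k + 3) = 2 * t (k + 2) + t k" for k
    using s_rec[of "k + 3"] s_rec[of "k + 2"] s_rec[of "k + 1"]
    by (simp add: t_def numeral_eq_Suc algebra_simps)
  have w3: "card (words 3) = 15"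
    using card_words_rec[of 0] card_words_small card_words_0 by (simp add: numeral_eq_Suc)
  have t: "t k = 59 * of_nat (card (words (k + 1)))" for k
  proof (induction k rule: less_induct)
    case (less k)
    have "k = 0 \<or> k = 1 \<or> k = 2 \<or> k = (k - 3) + 3" by arith
    then consider "k = 0" | "k = 1" | "k = 2" | l where "k = l + 3"
      by blast
    then show ?case
    proof cases
      case (4 l)
      then show ?thesis
        using less[of l] less[of "l + 2"] t_rec[of l] card_words_rec[of "l + 1"]
        by (simp add: numeral_eq_Suc)
    qed (use s1 s2 s3 s4 s5 card_words_small w3 in \<open>simp_all add: t_def numeral_eq_Suc\<close>)
  qed
  have summand: "(13 * inverse r + 11 - 5 * r) * inverse r ^ (m + 2) =
      13 * inverse r ^ (m + 3) + 11 * inverse r ^ (m + 2) - 5 * inverse r ^ (m + 1)"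
    if "r \<noteq> 0" for r :: complex
    using that by (simp add: algebra_simps numeral_eq_Suc)
  have "(\<Sum>\<alpha> | 1 - 2 * \<alpha> - \<alpha> ^ 3 = (0 :: complex).
      (13 * inverse \<alpha> + 11 - 5 * \<alpha>) * inverse \<alpha> ^ (m + 2)) = t m"
    unfolding roots using dist nz
    by (simp add: summand del: power_Suc add_2_eq_Suc')
       (simp add: t_def s_def x_def y_def z_def algebra_simps)
  with t show ?thesis by simp
qed

theorem mainTheorem1:
  shows "Abs_fps (\<lambda>n. of_nat (pds2D n) :: rat) =
           (fps_X ^ 5 + fps_X ^ 3 + fps_X ^ 2 - 2 * fps_X + 1) /
           ((1 - fps_X) * (1 - 2 * fps_X - fps_X ^ 3))
         \<and> pds2D 0 = 1
         \<and> pds2D 1 = 1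
         \<and> (\<forall>n\<ge>2. (of_nat (pds2D n) :: complex) =
              1 / 59 * (\<Sum>\<alpha> | 1 - 2 * \<alpha> - \<alpha> ^ 3 = 0.
                          (13 * inverse \<alpha> + 11 - 5 * \<alpha>) * inverse \<alpha> ^ n) - 1)"
proof (intro conjI allI impI)
  fix n :: nat
  assume "2 \<le> n"
  then obtain m where n: "n = m + 2" by (metis add.commute le_Suc_ex)
  show "(of_nat (pds2D n) :: complex) =
      1 / 59 * (\<Sum>\<alpha> | 1 - 2 * \<alpha> - \<alpha> ^ 3 = 0.
                  (13 * inverse \<alpha> + 11 - 5 * \<alpha>) * inverse \<alpha> ^ n) - 1"
    unfolding n of_nat_pds2D card_words_roots by simp
qed (fact pds2D_fps pds2D_0 pds2D_1)+

end
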